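(* Let $\delta\in(0,1)$ and let $M_r\in\mathbb{R}^{\rho_r\times p}$, $M_c\in\mathbb{R}^{n\times\rho_c}$ be subsampling matrices such that $$(1-\delta)\,\|Y\|_F^2\le\frac{np}{\rho_r\rho_c}\,\|M_rYM_c\|_F^2\le(1+\delta)\,\|Y\|_F^2\quad\text{for all }Y\in\mathcal{LR}(P_{k_r},Q_{k_c}).$$ Let $\gamma>0$, assume $\lambda_{k_c+1}>0$ and $\lambda_{k_r+1}>0$, and set $\bar\gamma_c=\gamma/\lambda_{k_c+1}$, $\bar\gamma_r=\gamma/\lambda_{k_r+1}$. Let $\bar X\in\mathcal{LR}(P_{k_r},Q_{k_c})$, $\tilde E\in\mathbb{R}^{\rho_r\times\rho_c}$ and $\tilde X=M_r\bar XM_c+\tilde E$. Let $X^*$ be a solution of $$\min_{X\in\mathbb{R}^{p\times n}}\ \|M_rXM_c-\tilde X\|_F^2+\bar\gamma_c\,\mathrm{tr}(X\mathcal{L}_cX^\top)+\bar\gamma_r\,\mathrm{tr}(X^\top\mathcal{L}_rX),$$ and let $\bar X^*$ be the orthogonal projection of $X^*$ onto $\mathcal{LR}(P_{k_r},Q_{k_c})$ and $E^*=X^*-\bar X^*$. Then $$\|\bar X^*-\bar X\|_F\le\sqrt{\frac{np}{\rho_c\rho_r(1-\delta)}}\left[\left(2+\frac{1}{\sqrt{2\gamma}}\right)\|\tilde E\|_F+\left(\frac{1}{\sqrt2}+\sqrt\gamma\right)\sqrt{\frac{\lambda_{k_c}}{\lambda_{k_c+1}}+\frac{\lambda_{k_r}}{\lambda_{k_r+1}}}\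 \|\bar X\|_F\right]$$ and $$\|E^*\|_F\le\frac{\|\tilde E\|_F}{\sqrt{2\gamma}}+\frac{1}{\sqrt2}\sqrt{\frac{\lambda_{k_c}}{\lambda_{k_c+1}}+\frac{\lambda_{k_r}}{\lambda_{k_r+1}}}\ \|\bar X\|_F.$$
   Context: $\mathcal{L}_c\in\mathbb{R}^{n\times n}$ and $\mathcal{L}_r\in\mathbb{R}^{p\times p}$ are Laplacians of two undirected graphs with nonnegative weights (on the columns and on the rows of $p\times n$ data matrices). Write $\mathcal{L}_c=Q\Lambda_cQ^\top$, $\mathcal{L}_r=P\Lambda_rP^\top$ with $Q,P$ orthogonal and eigenvalues sorted in increasing order; $Q_{k_c}\in\mathbb{R}^{n\times k_c}$ and $P_{k_r}\in\mathbb{R}^{p\times k_r}$ consist of the first $k_c$ columns of $Q$ and the first $k_r$ columns of $P$, with $k_c<n$, $k_r<p$. The symbols $\lambda_{k_c},\lambda_{k_c+1}$ denote the $k_c$-th and $(k_c+1)$-th smallest eigenvalues of $\mathcal{L}_c$, and $\lambda_{k_r},\lambda_{k_r+1}$ denote the $k_r$-th and $(k_r+1)$-th smallest eigenvalues of $\mathcal{L}_r$ (the subscript indicates which Laplacian is meant). $\mathcal{LR}(P_{k_r},Q_{k_c})$ is the linear space of matrices $Y\in\mathbb{R}^{p\times n}$ all of whose columns lie in $\mathrm{span}(P_{k_r})$ and all of whose rows (viewed as vectors of $\mathbb{R}^n$) lie in $\mathrm{span}(Q_{k_c})$, where span of a matrix means the span of its columns. Orthogonal projection is with respect to the Frobenius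 inner product. Subsampling matrices: for distinct indices $\omega_1,\dots,\omega_{\rho_c}\in\{1,\dots,n\}$, $(M_c)_{ij}=1$ if $i=\omega_j$ and $0$ otherwise; for distinct indices $\omega_1,\dots,\omega_{\rho_r}\in\{1,\dots,p\}$, $(M_r)_{ij}=1$ if $j=\omega_i$ and $0$ otherwise. *)

theory Defs
  imports Complex_Main "Jordan_Normal_Form.VS_Connect"
begin

definition mat_trace :: "real mat \<Rightarrow> real" where
  "mat_trace A = (\<Sum>i<dim_row A. A $$ (i, i))"

definition frob_inner :: "real mat \<Rightarrow> real mat \<Rightarrow> real" where
  "frob_inner A B = (\<Sum>i<dim_row A. \<Sum>j<dim_col A. A $$ (i, j) * B $$ (i, j))"

definition frob_norm :: "real mat \<Rightarrow> real" where
  "frob_norm A = sqrt (frob_inner A A)"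

(* Self-loops are not excluded: a diagonal weight adds the same amount to the
   degree matrix and to W, hence cancels in D - W. *)
definition weight_matrix :: "nat \<Rightarrow> real mat \<Rightarrow> bool" where
  "weight_matrix n W \<longleftrightarrow> W \<in> carrier_mat n n \<and> W\<^sup>T = W \<and>
     (\<forall>i<n. \<forall>j<n. 0 \<le> W $$ (i, j))"

definition laplacian :: "nat \<Rightarrow> real mat \<Rightarrow> real mat" where
  "laplacian n W = mat_diag n (\<lambda>i. \<Sum>j<n. W $$ (i, j)) - W"

(* Indices start at 0: lam (k - 1) is the k-th smallest eigenvalue of L, counted
   with multiplicity, and column k - 1 of Q is a corresponding unit eigenvector.
   The library predicate orthogonal_mat does not normalise the columns. *)
definition sorted_eigendecomposition ::
  "nat \<Rightarrow> real mat \<Rightarrow> real mat \<Rightarrow> (nat \<Rightarrow> real) \<Rightarrow> bool" where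
  "sorted_eigendecomposition n L Q lam \<longleftrightarrow>
     Q \<in> carrier_mat n n \<and> Q\<^sup>T * Q = 1\<^sub>m n \<and> mono_on {..<n} lam \<and>
     L = Q * mat_diag n lam * Q\<^sup>T"

definition first_columns :: "nat \<Rightarrow> real mat \<Rightarrow> real mat" where
  "first_columns k A = mat_of_cols (dim_row A) (take k (cols A))"

definition low_rank_space :: "real mat \<Rightarrow> real mat \<Rightarrow> real mat set" where
  "low_rank_space P Q = {Y \<in> carrier_mat (dim_row P) (dim_row Q).
     (\<forall>j<dim_row Q. col Y j \<in> vec_space.col_space (dim_row P) P) \<and>
     (\<forall>i<dim_row P. row Y i \<in> vec_space.col_space (dim_row Q) Q)}"

definition is_frob_projection :: "real mat set \<Rightarrow> real mat \<Rightarrow> real mat \<Rightarrow> bool" where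
  "is_frob_projection S X Y \<longleftrightarrow> Y \<in> S \<and> (\<forall>Z\<in>S. frob_inner (X - Y) Z = 0)"

definition column_subsampling :: "nat \<Rightarrow> nat \<Rightarrow> real mat \<Rightarrow> bool" where
  "column_subsampling n rho M \<longleftrightarrow> (\<exists>w. inj_on w {..<rho} \<and> w ` {..<rho} \<subseteq> {..<n} \<and>
     M = mat n rho (\<lambda>(i, j). if i = w j then 1 else 0))"

definition row_subsampling :: "nat \<Rightarrow> nat \<Rightarrow> real mat \<Rightarrow> bool" where
  "row_subsampling p rho M \<longleftrightarrow> (\<exists>w. inj_on w {..<rho} \<and> w ` {..<rho} \<subseteq> {..<p} \<and>
     M = mat rho p (\<lambda>(i, j). if j = w i then 1 else 0))"

definition decoder_objective ::
  "real mat \<Rightarrow> real mat \<Rightarrow> real mat \<Rightarrow> real mat \<Rightarrow> real mat \<Rightarrow> real \<Rightarrow> real \<Rightarrow> real mat \<Rightarrow> real" where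
  "decoder_objective Mr Mc Xt Lc Lr gc gr X =
     (frob_norm (Mr * X * Mc - Xt))\<^sup>2
       + gc * mat_trace (X * Lc * X\<^sup>T) + gr * mat_trace (X\<^sup>T * Lr * X)"

end

(* The objective is quadratic, so its minimiser Xs satisfies the growth inequality
   F Xs + q (Xs - Xbar) <= F Xbar, where q is the quadratic part of F; comparing the minimal
   value alone would lose the factor 1/sqrt 2 in the bounds. In the coordinates Z = P^T X Q both
   trace terms become a single sum of Z_ij^2 with weights
   lamc_j / lamc_kc + lamr_i / lamr_kr. The low-rank space is the block i < kr, j < kc, where the
   weights are at most s = lamc_(kc-1) / lamc_kc + lamr_(kr-1) / lamr_kr, while outside the block
   they are at least 1. As Es lives outside the block,
   |Mr Xs Mc - Xt|^2 + 2 gamma |Es|^2 <= |Et|^2 + gamma s |Xbar|^2,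
   which bounds Es; the restricted isometry turns the bound on the sampled difference
   Mr (Xbars - Xbar) Mc into the bound on Xbars - Xbar. *)
theory Submission
  imports Defs "HOL-Analysis.L2_Norm"
begin

section \<open>Traces and the Frobenius norm\<close>

lemma mult_mat_entry:
  assumes "A \<in> carrier_mat m k" "B \<in> carrier_mat k n" "i < m" "j < n"
  shows "(A * B) $$ (i, j) = (\<Sum>l<k. A $$ (i, l) * B $$ (l, j))"
  using assms by (auto simp: scalar_prod_def atLeast0LessThan intro!: sum.cong)

text \<open>This form makes the inner product accessible to the cyclicity of the trace, by which
  orthogonal factors cancel.\<close>

lemma frob_inner_eq_trace:
  assumes "A \<in> carrier_mat m n" "B \<in> carrier_mat m n"
  shows "frob_inner A B = mat_trace (A\<^sup>T * B)"
proof -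
  have "mat_trace (A\<^sup>T * B) = (\<Sum>j<n. \<Sum>i<m. A $$ (i, j) * B $$ (i, j))"
    unfolding mat_trace_def using assms
    by (auto simp: mult_mat_entry[of _ n m _ n] simp del: index_mult_mat(1) intro!: sum.cong)
  also have "\<dots> = (\<Sum>i<m. \<Sum>j<n. A $$ (i, j) * B $$ (i, j))"
    by (rule sum.swap)
  finally show ?thesis using assms by (simp add: frob_inner_def)
qed

lemma mat_trace_commute:
  assumes "A \<in> carrier_mat m n" "B \<in> carrier_mat n m"
  shows "mat_trace (A * B) = mat_trace (B * A)"
proof -
  have "mat_trace (A * B) = (\<Sum>i<m. \<Sum>j<n. A $$ (i, j) * B $$ (j, i))"
    unfolding mat_trace_def using assms
    by (auto simp: mult_mat_entry[of _ m n _ m] simp del: index_mult_mat(1) intro!: sum.cong)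
  also have "\<dots> = (\<Sum>j<n. \<Sum>i<m. B $$ (j, i) * A $$ (i, j))"
    by (subst sum.swap) (simp add: mult.commute)
  also have "\<dots> = mat_trace (B * A)"
    unfolding mat_trace_def using assms
    by (auto simp: mult_mat_entry[of _ n m _ n] simp del: index_mult_mat(1) intro!: sum.cong)
  finally show ?thesis .
qed

text \<open>Flattening both indices into one index set lets the Minkowski inequality for
  \<open>L2_set\<close> supply the triangle inequality.\<close>

lemma frob_norm_eq_L2_set:
  assumes "A \<in> carrier_mat m n"
  shows "frob_norm A = L2_set (\<lambda>(i, j). A $$ (i, j)) ({..<m} \<times> {..<n})"
  using assms
  by (simp add: frob_norm_def frob_inner_def L2_set_def sum.cartesian_product power2_eq_square
      case_prod_unfold)

lemma frob_norm_nonneg: "0 \<le> frob_norm A"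
  by (simp add: frob_norm_def frob_inner_def sum_nonneg)

lemma frob_norm_square:
  assumes "A \<in> carrier_mat m n"
  shows "(frob_norm A)\<^sup>2 = (\<Sum>i<m. \<Sum>j<n. (A $$ (i, j))\<^sup>2)"
  using assms by (simp add: frob_norm_def frob_inner_def sum_nonneg power2_eq_square)

lemma frob_norm_uminus: "frob_norm (- A) = frob_norm A"
  by (simp add: frob_norm_def frob_inner_def)

lemma frob_norm_triangle:
  assumes "A \<in> carrier_mat m n" "B \<in> carrier_mat m n"
  shows "frob_norm (A + B) \<le> frob_norm A + frob_norm B"
proof -
  have "frob_norm (A + B)
      = L2_set (\<lambda>x. (case x of (i, j) \<Rightarrow> A $$ (i, j)) + (case x of (i, j) \<Rightarrow> B $$ (i, j)))
          ({..<m} \<times> {..<n})"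
    using assms by (subst frob_norm_eq_L2_set[of _ m n]) (auto intro!: L2_set_cong)
  then show ?thesis
    using assms L2_set_triangle_ineq by (simp add: frob_norm_eq_L2_set[of _ m n])
qed

lemma frob_norm_triangle_diff:
  assumes "A \<in> carrier_mat m n" "B \<in> carrier_mat m n"
  shows "frob_norm (A - B) \<le> frob_norm A + frob_norm B"
  using frob_norm_triangle[of A m n "- B"] assms
  by (simp add: frob_norm_uminus add_uminus_minus_mat)

section \<open>Subsampling matrices\<close>

lemma column_subsampling_carrier:
  "column_subsampling n rho M \<Longrightarrow> M \<in> carrier_mat n rho"
  by (auto simp: column_subsampling_def)

lemma row_subsampling_carrier:
  "row_subsampling p rho M \<Longrightarrow> M \<in> carrier_mat rho p"
  by (auto simp: row_subsampling_def)

lemma row_subsampling_transpose: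
  assumes "row_subsampling p rho M"
  shows "column_subsampling p rho M\<^sup>T"
proof -
  obtain w where "inj_on w {..<rho}" "w ` {..<rho} \<subseteq> {..<p}"
    "M = mat rho p (\<lambda>(i, j). if j = w i then 1 else 0)"
    using assms by (auto simp: row_subsampling_def)
  then show ?thesis
    unfolding column_subsampling_def by (intro exI[of _ w]) auto
qed

lemma frob_norm_transpose: "frob_norm A\<^sup>T = frob_norm A"
  unfolding frob_norm_def frob_inner_def by (simp, subst sum.swap, simp)

text \<open>\<open>X * M\<close> lists the columns \<open>w j\<close> of \<open>X\<close>. Since
  \<open>w\<close> is injective, no column is counted twice, so its sum of squares is a partial sum
  of the one for \<open>X\<close>.\<close>

lemma frob_norm_mult_column_subsampling:
  assumes "column_subsampling n rho M" "X \<in> carrier_mat m n"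
  shows "frob_norm (X * M) \<le> frob_norm X"
proof -
  obtain w where w: "inj_on w {..<rho}" "w ` {..<rho} \<subseteq> {..<n}"
    and M: "M = mat n rho (\<lambda>(i, j). if i = w j then 1 else 0)"
    using assms(1) by (auto simp: column_subsampling_def)
  have entry: "(X * M) $$ (i, j) = X $$ (i, w j)" if "i < m" "j < rho" for i j
  proof -
    have "(X * M) $$ (i, j) = (\<Sum>l<n. X $$ (i, l) * M $$ (l, j))"
      using that assms(2) M by (intro mult_mat_entry) auto
    also have "\<dots> = (\<Sum>l<n. if l = w j then X $$ (i, l) else 0)"
      using that by (intro sum.cong) (auto simp: M)
    also have "\<dots> = X $$ (i, w j)"
      using that w(2) by (auto simp: image_subset_iff)
    finally show ?thesis .
  qed
  have "(frob_norm (X * M))\<^sup>2 = (\<Sum>i<m. \<Sum>j<rho. (X $$ (i, w j))\<^sup>2)"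
    unfolding frob_norm_square[OF mult_carrier_mat[OF assms(2) column_subsampling_carrier[OF assms(1)]]]
    by (intro sum.cong refl) (simp add: entry del: index_mult_mat(1))
  also have "\<dots> = (\<Sum>i<m. \<Sum>j\<in>w ` {..<rho}. (X $$ (i, j))\<^sup>2)"
    by (simp add: sum.reindex[OF w(1)])
  also have "\<dots> \<le> (\<Sum>i<m. \<Sum>j<n. (X $$ (i, j))\<^sup>2)"
    using w(2) by (intro sum_mono sum_mono2) auto
  also have "\<dots> = (frob_norm X)\<^sup>2"
    using assms(2) by (simp add: frob_norm_square)
  finally show ?thesis
    by (rule power2_le_imp_le) (rule frob_norm_nonneg)
qed

text \<open>Selecting rows is selecting columns of the transpose, so the column estimate is used
  twice.\<close>

lemma frob_norm_subsampling:
  assumes Mr: "row_subsampling p rhor Mr" and Mc: "column_subsampling n rhoc Mc"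
    and X: "X \<in> carrier_mat p n"
  shows "frob_norm (Mr * X * Mc) \<le> frob_norm X"
proof -
  have MrX: "Mr * X \<in> carrier_mat rhor n"
    using row_subsampling_carrier[OF Mr] X by simp
  have "frob_norm (Mr * X * Mc) \<le> frob_norm (Mr * X)"
    by (rule frob_norm_mult_column_subsampling[OF Mc MrX])
  also have "\<dots> = frob_norm (X\<^sup>T * Mr\<^sup>T)"
    unfolding transpose_mult[OF row_subsampling_carrier[OF Mr] X, symmetric]
    by (rule frob_norm_transpose[symmetric])
  also have "\<dots> \<le> frob_norm X"
    using frob_norm_mult_column_subsampling[OF row_subsampling_transpose[OF Mr], of "X\<^sup>T" n] X
    by (simp add: frob_norm_transpose)
  finally show ?thesis .
qed

section \<open>Nonnegativity of Laplacian spectra\<close>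

text \<open>Twice the quadratic form is the sum of \<open>W $$ (i, j) * (x i - x j)\<^sup>2\<close>
  over all ordered pairs, and the weights are nonnegative.\<close>

lemma laplacian_psd:
  assumes W: "weight_matrix n W"
  shows "0 \<le> (\<Sum>i<n. \<Sum>j<n. x i * laplacian n W $$ (i, j) * x j)"
proof -
  have Wc: "W \<in> carrier_mat n n" and nonneg: "\<And>i j. i < n \<Longrightarrow> j < n \<Longrightarrow> 0 \<le> W $$ (i, j)"
    using W by (auto simp: weight_matrix_def)
  have sym: "W $$ (j, i) = W $$ (i, j)" if "i < n" "j < n" for i j
    using W that Wc by (metis weight_matrix_def index_transpose_mat(1) carrier_matD)
  define d where "d i = (\<Sum>j<n. W $$ (i, j))" for i
  have row: "(\<Sum>j<n. x i * laplacian n W $$ (i, j) * x j)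
      = (\<Sum>j<n. W $$ (i, j) * (x i)\<^sup>2) - (\<Sum>j<n. W $$ (i, j) * (x i * x j))" if "i < n" for i
  proof -
    have "(\<Sum>j<n. x i * laplacian n W $$ (i, j) * x j)
        = (\<Sum>j<n. (if j = i then d i * (x i)\<^sup>2 else 0) - W $$ (i, j) * (x i * x j))"
      using that Wc
      by (intro sum.cong)
        (auto simp: laplacian_def mat_diag_def d_def power2_eq_square algebra_simps)
    also have "\<dots> = d i * (x i)\<^sup>2 - (\<Sum>j<n. W $$ (i, j) * (x i * x j))"
      using that by (simp add: sum_subtractf)
    finally show ?thesis by (simp add: d_def sum_distrib_right)
  qed
  define a where "a = (\<Sum>i<n. \<Sum>j<n. W $$ (i, j) * (x i)\<^sup>2)"
  define b where "b = (\<Sum>i<n. \<Sum>j<n. W $$ (i, j) * (x i * x j))"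
  \<comment> \<open>By symmetry of \<open>W\<close>, both pure squares in the expansion of
    \<open>(x i - x j)\<^sup>2\<close> contribute the same degree term \<open>a\<close>.\<close>
  have a': "a = (\<Sum>i<n. \<Sum>j<n. W $$ (i, j) * (x j)\<^sup>2)"
    unfolding a_def by (subst sum.swap) (auto intro!: sum.cong simp: sym)
  have "(\<Sum>i<n. \<Sum>j<n. W $$ (i, j) * (x i - x j)\<^sup>2)
      = (\<Sum>i<n. \<Sum>j<n. W $$ (i, j) * (x i)\<^sup>2 + W $$ (i, j) * (x j)\<^sup>2
          - 2 * (W $$ (i, j) * (x i * x j)))"
    by (intro sum.cong refl) (simp add: power2_diff algebra_simps)
  also have "\<dots> = a + a - 2 * b"
    by (simp add: sum.distrib sum_subtractf flip: sum_distrib_left a_def a' b_def)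
  finally have "2 * (a - b) = (\<Sum>i<n. \<Sum>j<n. W $$ (i, j) * (x i - x j)\<^sup>2)"
    by simp
  also have "\<dots> \<ge> 0"
    using nonneg by (intro sum_nonneg) auto
  finally have "a - b \<ge> 0" by simp
  moreover have "(\<Sum>i<n. \<Sum>j<n. x i * laplacian n W $$ (i, j) * x j) = a - b"
    by (simp add: row a_def b_def sum_subtractf)
  ultimately show ?thesis by simp
qed

lemma orthogonal_right_inverse:
  fixes Q :: "real mat"
  assumes "Q \<in> carrier_mat n n" "Q\<^sup>T * Q = 1\<^sub>m n"
  shows "Q * Q\<^sup>T = 1\<^sub>m n"
  using mat_mult_left_right_inverse[of "Q\<^sup>T" n Q] assms by simp

text \<open>\<open>lam j\<close> is a diagonal entry of \<open>Q\<^sup>T * L * Q\<close> for the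
  Laplacian \<open>L\<close>, hence the value of the quadratic form of \<open>L\<close> at column
  \<open>j\<close> of \<open>Q\<close>.\<close>

lemma laplacian_eigenvalue_nonneg:
  assumes W: "weight_matrix n W"
    and decomp: "sorted_eigendecomposition n (laplacian n W) Q lam"
    and j: "j < n"
  shows "0 \<le> lam j"
proof -
  define L where "L = laplacian n W"
  have Q: "Q \<in> carrier_mat n n" and QQ: "Q\<^sup>T * Q = 1\<^sub>m n" and L: "L = Q * mat_diag n lam * Q\<^sup>T"
    using decomp by (auto simp: sorted_eigendecomposition_def L_def)
  have D: "mat_diag n lam \<in> carrier_mat n n" by simp
  have Lc: "L \<in> carrier_mat n n" unfolding L using Q D by (meson mult_carrier_mat transpose_carrier_mat)
  have "Q\<^sup>T * L * Q = (Q\<^sup>T * Q) * mat_diag n lam * (Q\<^sup>T * Q)"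
    unfolding L using Q D by (simp add: assoc_mult_mat[of _ n n _ n _ n] del: mat_diag_dim)
  also have "\<dots> = mat_diag n lam"
    unfolding QQ left_mult_one_mat[OF D] by (rule right_mult_one_mat[OF D])
  finally have "lam j = (Q\<^sup>T * L * Q) $$ (j, j)"
    using j by (simp add: mat_diag_def)
  also have "\<dots> = (\<Sum>b<n. (Q\<^sup>T * L) $$ (j, b) * Q $$ (b, j))"
    by (rule mult_mat_entry) (use Q Lc j in auto)
  also have "\<dots> = (\<Sum>b<n. (\<Sum>a<n. Q\<^sup>T $$ (j, a) * L $$ (a, b)) * Q $$ (b, j))"
    by (intro sum.cong refl arg_cong2[of _ _ _ _ "(*)"] mult_mat_entry) (use Q Lc j in auto)
  also have "\<dots> = (\<Sum>b<n. \<Sum>a<n. Q $$ (a, j) * L $$ (a, b) * Q $$ (b, j))"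
    using Q j by (simp add: sum_distrib_right)
  also have "\<dots> = (\<Sum>a<n. \<Sum>b<n. Q $$ (a, j) * L $$ (a, b) * Q $$ (b, j))"
    by (rule sum.swap)
  also have "\<dots> \<ge> 0"
    unfolding L_def by (rule laplacian_psd[OF W])
  finally show ?thesis .
qed

section \<open>The low-rank space in spectral coordinates\<close>

text \<open>The columns of \<open>Q\<close> form an orthonormal basis in which \<open>v\<close> has
  the coordinates \<open>Q\<^sup>T *\<^sub>v v\<close>; membership in the span of the first
  \<open>k\<close> means that the later coordinates vanish.\<close>

lemma mem_col_space_first_columns:
  assumes Q: "Q \<in> carrier_mat n n" "Q\<^sup>T * Q = 1\<^sub>m n" and k: "k \<le> n"
    and v: "v \<in> carrier_vec n"
  shows "v \<in> vec_space.col_space n (first_columns k Q)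
    \<longleftrightarrow> (\<forall>i. k \<le> i \<longrightarrow> i < n \<longrightarrow> (Q\<^sup>T *\<^sub>v v) $ i = 0)"
proof -
  \<comment> \<open>\<open>J\<close> embeds the first \<open>k\<close> coordinates and pads with
    zeros. Writing the truncated matrix as \<open>Q * J\<close> turns its column space into the
    image of a product, where \<open>Q\<close> can be cancelled.\<close>
  define J :: "real mat" where "J = mat n k (\<lambda>(i, j). if i = j then 1 else 0)"
  have J: "J \<in> carrier_mat n k" by (simp add: J_def)
  have Jx: "J *\<^sub>v x = vec n (\<lambda>i. if i < k then x $ i else 0)" if "x \<in> carrier_vec k" for x
  proof (rule eq_vecI)
    fix i assume "i < dim_vec (vec n (\<lambda>i. if i < k then x $ i else 0))"
    then have i: "i < n" by simp
    have "(J *\<^sub>v x) $ i = (\<Sum>l<k. (if i = l then 1 else 0) * x $ l)"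
      using i that by (simp add: J_def scalar_prod_def atLeast0LessThan)
    also have "\<dots> = (\<Sum>l<k. if l = i then x $ l else 0)"
      by (intro sum.cong) auto
    finally have "(J *\<^sub>v x) $ i = (\<Sum>l<k. if l = i then x $ l else 0)" .
    then show "(J *\<^sub>v x) $ i = vec n (\<lambda>i. if i < k then x $ i else 0) $ i"
      using i by simp
  qed (simp add: J_def)
  have first: "first_columns k Q = Q * J"
  proof (rule eq_matI)
    fix i j assume "i < dim_row (Q * J)" "j < dim_col (Q * J)"
    then have ij: "i < n" "j < k" using Q J by auto
    have "(Q * J) $$ (i, j) = (\<Sum>l<n. Q $$ (i, l) * J $$ (l, j))"
      by (rule mult_mat_entry) (use Q J ij in auto)
    also have "\<dots> = (\<Sum>l<n. if l = j then Q $$ (i, l) else 0)"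
      using ij by (intro sum.cong) (auto simp: J_def)
    also have "\<dots> = Q $$ (i, j)" using ij k by simp
    finally show "first_columns k Q $$ (i, j) = (Q * J) $$ (i, j)"
      using ij Q k by (simp add: first_columns_def mat_of_cols_index)
  qed (use Q J k in \<open>auto simp: first_columns_def\<close>)
  have QJ: "Q * J \<in> carrier_mat n k" using Q J by simp
  have space: "v \<in> vec_space.col_space n (first_columns k Q)
      \<longleftrightarrow> (\<exists>x\<in>carrier_vec k. (Q * J) *\<^sub>v x = v)"
    unfolding first vec_space.col_space_eq[OF QJ] carrier_matD[OF QJ] using v by blast
  show ?thesis
  proof
    assume "v \<in> vec_space.col_space n (first_columns k Q)"
    then obtain x where x: "x \<in> carrier_vec k" and vx: "(Q * J) *\<^sub>v x = v"
      unfolding space by blast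
    have Jxc: "J *\<^sub>v x \<in> carrier_vec n" using J x by simp
    have "Q\<^sup>T *\<^sub>v v = Q\<^sup>T *\<^sub>v (Q *\<^sub>v (J *\<^sub>v x))"
      using vx Q(1) J x by simp
    also have "\<dots> = (Q\<^sup>T * Q) *\<^sub>v (J *\<^sub>v x)"
      by (rule assoc_mult_mat_vec[symmetric, of _ n n _ n]) (use Q(1) Jxc in auto)
    also have "\<dots> = J *\<^sub>v x"
      using Q(2) Jxc by simp
    finally show "\<forall>i. k \<le> i \<longrightarrow> i < n \<longrightarrow> (Q\<^sup>T *\<^sub>v v) $ i = 0"
      by (simp add: Jx[OF x])
  next
    assume zero: "\<forall>i. k \<le> i \<longrightarrow> i < n \<longrightarrow> (Q\<^sup>T *\<^sub>v v) $ i = 0"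
    \<comment> \<open>The preimage consists of the first \<open>k\<close> coordinates of
      \<open>v\<close>; padding them by \<open>J\<close> loses nothing, as the others are
      zero.\<close>
    define x where "x = vec k (\<lambda>i. (Q\<^sup>T *\<^sub>v v) $ i)"
    have x: "x \<in> carrier_vec k" by (simp add: x_def)
    have "J *\<^sub>v x = Q\<^sup>T *\<^sub>v v"
      unfolding Jx[OF x]
      by (rule eq_vecI) (use Q(1) zero in \<open>auto simp: x_def simp del: index_mult_mat_vec\<close>)
    then have "(Q * J) *\<^sub>v x = Q *\<^sub>v (Q\<^sup>T *\<^sub>v v)"
      using Q(1) J x by simp
    also have "\<dots> = (Q * Q\<^sup>T) *\<^sub>v v"
      by (rule assoc_mult_mat_vec[symmetric, of _ n n _ n]) (use Q(1) v in auto)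
    also have "\<dots> = v"
      using v by (simp add: orthogonal_right_inverse[OF Q])
    finally show "v \<in> vec_space.col_space n (first_columns k Q)"
      unfolding space using x by blast
  qed
qed

text \<open>Entry \<open>(i, j)\<close> is the coordinate of \<open>X\<close> along the rank-one
  matrix formed from column \<open>i\<close> of \<open>P\<close> and column \<open>j\<close> of
  \<open>Q\<close>; for orthogonal \<open>P\<close> and \<open>Q\<close> these matrices are a
  Frobenius-orthonormal basis.\<close>

definition spectral_coeffs :: "real mat \<Rightarrow> real mat \<Rightarrow> real mat \<Rightarrow> real mat" where
  "spectral_coeffs P Q X = P\<^sup>T * X * Q"

lemma spectral_coeffs_carrier:
  assumes "P \<in> carrier_mat p p" "Q \<in> carrier_mat n n" "X \<in> carrier_mat p n"
  shows "spectral_coeffs P Q X \<in> carrier_mat p n"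
  using assms by (auto simp: spectral_coeffs_def intro!: mult_carrier_mat)

text \<open>Transfers statements about the column Laplacian to the row Laplacian.\<close>

lemma spectral_coeffs_transpose:
  assumes "P \<in> carrier_mat p p" "Q \<in> carrier_mat n n" "X \<in> carrier_mat p n"
  shows "spectral_coeffs Q P X\<^sup>T = (spectral_coeffs P Q X)\<^sup>T"
proof -
  have "(P\<^sup>T * X * Q)\<^sup>T = Q\<^sup>T * (P\<^sup>T * X)\<^sup>T"
    by (rule transpose_mult[of _ p n _ n]) (use assms in auto)
  also have "\<dots> = Q\<^sup>T * (X\<^sup>T * P)"
    using assms by (subst transpose_mult[of _ p p _ n]) auto
  also have "\<dots> = Q\<^sup>T * X\<^sup>T * P"
    by (rule assoc_mult_mat[symmetric, of _ n n _ p _ p]) (use assms in auto)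
  finally show ?thesis by (simp add: spectral_coeffs_def)
qed

text \<open>Each identity cancels an orthogonal matrix against its transpose. The first two undo
  only one of the two basis changes, which allows conditions on columns and on rows to be treated
  separately.\<close>

lemma spectral_expansion:
  assumes P: "P \<in> carrier_mat p p" "P\<^sup>T * P = 1\<^sub>m p" and Q: "Q \<in> carrier_mat n n" "Q\<^sup>T * Q = 1\<^sub>m n"
    and X: "X \<in> carrier_mat p n"
  shows "spectral_coeffs P Q X * Q\<^sup>T = P\<^sup>T * X" "P * spectral_coeffs P Q X = X * Q"
    "P * spectral_coeffs P Q X * Q\<^sup>T = X"
proof -
  have "spectral_coeffs P Q X * Q\<^sup>T = P\<^sup>T * X * (Q * Q\<^sup>T)"
    unfolding spectral_coeffs_def by (rule assoc_mult_mat[of _ p n _ n _ n]) (use P Q X in auto)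
  then show right: "spectral_coeffs P Q X * Q\<^sup>T = P\<^sup>T * X"
    using P X orthogonal_right_inverse[OF Q] by simp
  have "spectral_coeffs P Q X = P\<^sup>T * (X * Q)"
    unfolding spectral_coeffs_def by (rule assoc_mult_mat[of _ p p _ n _ n]) (use P Q X in auto)
  then have "P * spectral_coeffs P Q X = P * (P\<^sup>T * (X * Q))"
    by simp
  also have "\<dots> = (P * P\<^sup>T) * (X * Q)"
    by (rule assoc_mult_mat[symmetric, of _ p p _ p _ n]) (use P Q X in auto)
  finally have "P * spectral_coeffs P Q X = (P * P\<^sup>T) * (X * Q)" .
  then show left: "P * spectral_coeffs P Q X = X * Q"
    using Q X orthogonal_right_inverse[OF P] by simp
  have "X * Q * Q\<^sup>T = X * (Q * Q\<^sup>T)"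
    by (rule assoc_mult_mat) (use Q X in auto)
  then show "P * spectral_coeffs P Q X * Q\<^sup>T = X"
    using X orthogonal_right_inverse[OF Q] by (simp add: left)
qed

lemma mult_mat_zero_row:
  assumes "A \<in> carrier_mat m k" "B \<in> carrier_mat k n" "i < m" "j < n"
    and "\<And>l. l < k \<Longrightarrow> A $$ (i, l) = 0"
  shows "(A * B) $$ (i, j) = (0 :: real)"
  using assms by (simp add: mult_mat_entry[of _ m k _ n] del: index_mult_mat(1))

lemma mult_mat_zero_col:
  assumes "A \<in> carrier_mat m k" "B \<in> carrier_mat k n" "i < m" "j < n"
    and "\<And>l. l < k \<Longrightarrow> B $$ (l, j) = 0"
  shows "(A * B) $$ (i, j) = (0 :: real)"
  using assms by (simp add: mult_mat_entry[of _ m k _ n] del: index_mult_mat(1))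

text \<open>The condition on columns says that the rows of \<open>P\<^sup>T * Y\<close> from
  \<open>kr\<close> on vanish, the condition on rows that the columns of \<open>Y * Q\<close> from
  \<open>kc\<close> on vanish. The orthogonal factor still missing acts on the other side, so zero
  rows or columns persist when it is applied and when it is undone.\<close>

lemma low_rank_space_iff:
  assumes P: "P \<in> carrier_mat p p" "P\<^sup>T * P = 1\<^sub>m p" and Q: "Q \<in> carrier_mat n n" "Q\<^sup>T * Q = 1\<^sub>m n"
    and k: "kr \<le> p" "kc \<le> n"
  shows "Y \<in> low_rank_space (first_columns kr P) (first_columns kc Q)
    \<longleftrightarrow> Y \<in> carrier_mat p n \<and>
      (\<forall>i<p. \<forall>j<n. kr \<le> i \<or> kc \<le> j \<longrightarrow> spectral_coeffs P Q Y $$ (i, j) = 0)"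
proof (cases "Y \<in> carrier_mat p n")
  case Y: True
  have dims: "dim_row (first_columns kr P) = p" "dim_row (first_columns kc Q) = n"
    using P Q by (auto simp: first_columns_def)
  have cols: "col Y j \<in> vec_space.col_space p (first_columns kr P)
      \<longleftrightarrow> (\<forall>i. kr \<le> i \<longrightarrow> i < p \<longrightarrow> (P\<^sup>T * Y) $$ (i, j) = 0)" if "j < n" for j
    using that P Y k by (subst mem_col_space_first_columns[OF P]) auto
  \<comment> \<open>The coordinates of row \<open>i\<close> of \<open>Y\<close> in the basis
    \<open>Q\<close> are the entries of row \<open>i\<close> of \<open>Y * Q\<close>, up to the
    order of the factors in the scalar product.\<close>
  have rows: "row Y i \<in> vec_space.col_space n (first_columns kc Q)
      \<longleftrightarrow> (\<forall>j. kc \<le> j \<longrightarrow> j < n \<longrightarrow> (Y * Q) $$ (i, j) = 0)" if "i < p" for i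
    using that Q Y k by (subst mem_col_space_first_columns[OF Q])
      (auto simp: comm_scalar_prod[of "row Y i" n])
  have Z: "spectral_coeffs P Q Y \<in> carrier_mat p n"
    by (rule spectral_coeffs_carrier[OF P(1) Q(1) Y])
  have PY: "P\<^sup>T * Y \<in> carrier_mat p n" and YQ: "Y * Q \<in> carrier_mat p n" using P Q Y by auto
  have Z_eq: "spectral_coeffs P Q Y = P\<^sup>T * (Y * Q)"
    unfolding spectral_coeffs_def using P Q Y by simp
  have upper: "(\<forall>j<n. (P\<^sup>T * Y) $$ (i, j) = 0) \<longleftrightarrow> (\<forall>j<n. spectral_coeffs P Q Y $$ (i, j) = 0)"
    if "i < p" for i
  proof
    assume "\<forall>j<n. (P\<^sup>T * Y) $$ (i, j) = 0"
    then show "\<forall>j<n. spectral_coeffs P Q Y $$ (i, j) = 0"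
      unfolding spectral_coeffs_def using mult_mat_zero_row[OF PY Q(1) that] by blast
  next
    assume *: "\<forall>j<n. spectral_coeffs P Q Y $$ (i, j) = 0"
    have QT: "Q\<^sup>T \<in> carrier_mat n n" using Q by simp
    show "\<forall>j<n. (P\<^sup>T * Y) $$ (i, j) = 0"
      unfolding spectral_expansion(1)[OF P Q Y, symmetric]
      using mult_mat_zero_row[OF Z QT that] * by blast
  qed
  have lower: "(\<forall>i<p. (Y * Q) $$ (i, j) = 0) \<longleftrightarrow> (\<forall>i<p. spectral_coeffs P Q Y $$ (i, j) = 0)"
    if "j < n" for j
  proof
    assume *: "\<forall>i<p. (Y * Q) $$ (i, j) = 0"
    have PT: "P\<^sup>T \<in> carrier_mat p p" using P by simp
    show "\<forall>i<p. spectral_coeffs P Q Y $$ (i, j) = 0"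
      unfolding Z_eq using mult_mat_zero_col[OF PT YQ _ that] * by blast
  next
    assume "\<forall>i<p. spectral_coeffs P Q Y $$ (i, j) = 0"
    then show "\<forall>i<p. (Y * Q) $$ (i, j) = 0"
      unfolding spectral_expansion(2)[OF P Q Y, symmetric]
      using mult_mat_zero_col[OF P(1) Z _ that] by blast
  qed
  have "Y \<in> low_rank_space (first_columns kr P) (first_columns kc Q)
      \<longleftrightarrow> (\<forall>j<n. col Y j \<in> vec_space.col_space p (first_columns kr P))
        \<and> (\<forall>i<p. row Y i \<in> vec_space.col_space n (first_columns kc Q))"
    using Y by (simp add: low_rank_space_def dims)
  also have "\<dots> \<longleftrightarrow> (\<forall>j<n. \<forall>i. kr \<le> i \<longrightarrow> i < p \<longrightarrow> (P\<^sup>T * Y) $$ (i, j) = 0)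
        \<and> (\<forall>i<p. \<forall>j. kc \<le> j \<longrightarrow> j < n \<longrightarrow> (Y * Q) $$ (i, j) = 0)"
    by (simp only: cols rows cong: imp_cong)
  also have "\<dots> \<longleftrightarrow> (\<forall>i<p. kr \<le> i \<longrightarrow> (\<forall>j<n. (P\<^sup>T * Y) $$ (i, j) = 0))
        \<and> (\<forall>j<n. kc \<le> j \<longrightarrow> (\<forall>i<p. (Y * Q) $$ (i, j) = 0))"
    by (intro arg_cong2[of _ _ _ _ "(\<and>)"]) blast+
  also have "\<dots> \<longleftrightarrow> (\<forall>i<p. kr \<le> i \<longrightarrow> (\<forall>j<n. spectral_coeffs P Q Y $$ (i, j) = 0))
        \<and> (\<forall>j<n. kc \<le> j \<longrightarrow> (\<forall>i<p. spectral_coeffs P Q Y $$ (i, j) = 0))"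
    by (simp only: upper lower cong: imp_cong)
  finally show ?thesis using Y by auto
qed (use P Q in \<open>auto simp: low_rank_space_def first_columns_def\<close>)

section \<open>Inner product and trace penalties in spectral coordinates\<close>

text \<open>The orthogonal factors cancel under the trace. For equal arguments this is Parseval's
  identity; paired with a basis matrix it reads off one coefficient.\<close>

lemma frob_inner_spectral_coeffs:
  assumes P: "P \<in> carrier_mat p p" "P\<^sup>T * P = 1\<^sub>m p" and Q: "Q \<in> carrier_mat n n" "Q\<^sup>T * Q = 1\<^sub>m n"
    and X: "X \<in> carrier_mat p n" and Y: "Y \<in> carrier_mat p n"
  shows "frob_inner (spectral_coeffs P Q X) (spectral_coeffs P Q Y) = frob_inner X Y"
proof -
  let ?Z = "spectral_coeffs P Q"
  have Z: "?Z X \<in> carrier_mat p n" "?Z Y \<in> carrier_mat p n"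
    using spectral_coeffs_carrier[OF P(1) Q(1)] X Y by auto
  have ZT: "(?Z X)\<^sup>T = Q\<^sup>T * (X\<^sup>T * P)"
    using spectral_coeffs_transpose[OF P(1) Q(1) X, symmetric] P Q X
    by (simp add: spectral_coeffs_def)
  have "(?Z X)\<^sup>T * ?Z Y = Q\<^sup>T * (X\<^sup>T * P * ?Z Y)"
    unfolding ZT by (rule assoc_mult_mat[of _ n n _ p _ n]) (use P Q X Z in auto)
  also have "X\<^sup>T * P * ?Z Y = X\<^sup>T * (P * ?Z Y)"
    by (rule assoc_mult_mat[of _ n p _ p _ n]) (use P X Z in auto)
  also have "Q\<^sup>T * (X\<^sup>T * (P * ?Z Y)) = Q\<^sup>T * (X\<^sup>T * (Y * Q))"
    by (simp add: spectral_expansion(2)[OF P Q Y])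
  finally have "frob_inner (?Z X) (?Z Y) = mat_trace (Q\<^sup>T * (X\<^sup>T * (Y * Q)))"
    using frob_inner_eq_trace[OF Z] by simp
  also have "\<dots> = mat_trace (X\<^sup>T * (Y * Q) * Q\<^sup>T)"
    by (rule mat_trace_commute[of _ n n]) (use Q X Y in auto)
  also have "X\<^sup>T * (Y * Q) * Q\<^sup>T = X\<^sup>T * (Y * Q * Q\<^sup>T)"
    by (rule assoc_mult_mat[of _ n p _ n _ n]) (use Q X Y in auto)
  also have "Y * Q * Q\<^sup>T = Y * (Q * Q\<^sup>T)"
    by (rule assoc_mult_mat[of _ p n _ n _ n]) (use Q Y in auto)
  also have "X\<^sup>T * (Y * (Q * Q\<^sup>T)) = X\<^sup>T * Y"
    using Y by (simp add: orthogonal_right_inverse[OF Q])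
  also have "mat_trace (X\<^sup>T * Y) = frob_inner X Y"
    by (rule frob_inner_eq_trace[OF X Y, symmetric])
  finally show ?thesis .
qed

text \<open>Let \<open>Z\<close> be the coefficients and \<open>D\<close> the diagonal matrix of
  eigenvalues. From \<open>X * Q = P * Z\<close> follows
  \<open>X * L * X\<^sup>T = P * (Z * D * Z\<^sup>T) * P\<^sup>T\<close>; cyclicity removes
  \<open>P\<close>, and \<open>D\<close> puts the weight \<open>lam j\<close> on column
  \<open>j\<close>.\<close>

lemma mat_trace_spectral_coeffs:
  assumes P: "P \<in> carrier_mat p p" "P\<^sup>T * P = 1\<^sub>m p"
    and decomp: "sorted_eigendecomposition n L Q lam" and X: "X \<in> carrier_mat p n"
  shows "mat_trace (X * L * X\<^sup>T) = (\<Sum>i<p. \<Sum>j<n. (spectral_coeffs P Q X $$ (i, j))\<^sup>2 * lam j)"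
proof -
  let ?Z = "spectral_coeffs P Q X" and ?D = "mat_diag n lam"
  have Q: "Q \<in> carrier_mat n n" "Q\<^sup>T * Q = 1\<^sub>m n" and L: "L = Q * ?D * Q\<^sup>T"
    using decomp by (auto simp: sorted_eigendecomposition_def)
  have D: "?D \<in> carrier_mat n n" by simp
  have Z: "?Z \<in> carrier_mat p n" by (rule spectral_coeffs_carrier[OF P(1) Q(1) X])
  have ZT: "Q\<^sup>T * X\<^sup>T = ?Z\<^sup>T * P\<^sup>T"
    using arg_cong[OF spectral_expansion(2)[OF P Q X], of transpose_mat] P Q X Z
    by (simp add: transpose_mult[of _ p p _ n] transpose_mult[of _ p n _ n])
  have ZDZ: "?Z * ?D * ?Z\<^sup>T \<in> carrier_mat p p"
    using Z D by (meson mult_carrier_mat transpose_carrier_mat)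
  have "X * L * X\<^sup>T = (X * Q) * ?D * (Q\<^sup>T * X\<^sup>T)"
    unfolding L using X Q D
    by (simp add: assoc_mult_mat[of _ p n _ n _ p] assoc_mult_mat[of _ p n _ n _ n]
        assoc_mult_mat[of _ n n _ n _ n] assoc_mult_mat[of _ n n _ n _ p] del: mat_diag_dim)
  also have "\<dots> = (P * ?Z) * ?D * (?Z\<^sup>T * P\<^sup>T)"
    by (simp add: ZT spectral_expansion(2)[OF P Q X])
  also have "\<dots> = P * (?Z * ?D * ?Z\<^sup>T * P\<^sup>T)"
    using P Z D
    by (simp add: assoc_mult_mat[of _ p p _ n _ p] assoc_mult_mat[of _ p p _ n _ n]
        assoc_mult_mat[of _ p n _ n _ p] assoc_mult_mat[of _ p n _ p _ p]
        assoc_mult_mat[of _ n n _ p _ p] del: mat_diag_dim)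
  finally have "mat_trace (X * L * X\<^sup>T) = mat_trace (P * (?Z * ?D * ?Z\<^sup>T * P\<^sup>T))"
    by simp
  also have "\<dots> = mat_trace (?Z * ?D * ?Z\<^sup>T * P\<^sup>T * P)"
    by (rule mat_trace_commute[of _ p p]) (use P ZDZ in auto)
  also have "?Z * ?D * ?Z\<^sup>T * P\<^sup>T * P = ?Z * ?D * ?Z\<^sup>T * (P\<^sup>T * P)"
    by (rule assoc_mult_mat[OF ZDZ]) (use P in auto)
  also have "\<dots> = ?Z * ?D * ?Z\<^sup>T"
    unfolding P(2) by (rule right_mult_one_mat[OF ZDZ])
  also have "mat_trace (?Z * ?D * ?Z\<^sup>T) = (\<Sum>i<p. \<Sum>j<n. (?Z * ?D) $$ (i, j) * ?Z\<^sup>T $$ (j, i))"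
    unfolding mat_trace_def carrier_matD(1)[OF ZDZ]
    by (intro sum.cong refl mult_mat_entry) (use Z mult_carrier_mat[OF Z D] in auto)
  also have "\<dots> = (\<Sum>i<p. \<Sum>j<n. (?Z $$ (i, j))\<^sup>2 * lam j)"
    using Z by (simp add: mat_diag_mult_right[of _ p n] power2_eq_square mult_ac)
  finally show ?thesis .
qed

section \<open>Quadratic growth at a minimiser\<close>

lemma mult_mat_linear_combination:
  fixes A B X Y :: "real mat"
  assumes A: "A \<in> carrier_mat m p" and B: "B \<in> carrier_mat n l"
    and X: "X \<in> carrier_mat p n" and Y: "Y \<in> carrier_mat p n"
  shows "A * (a \<cdot>\<^sub>m X + b \<cdot>\<^sub>m Y) * B = a \<cdot>\<^sub>m (A * X * B) + b \<cdot>\<^sub>m (A * Y * B)"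
proof -
  have "A * (a \<cdot>\<^sub>m X + b \<cdot>\<^sub>m Y) = A * (a \<cdot>\<^sub>m X) + A * (b \<cdot>\<^sub>m Y)"
    by (rule mult_add_distrib_mat) (use A X Y in auto)
  also have "\<dots> = a \<cdot>\<^sub>m (A * X) + b \<cdot>\<^sub>m (A * Y)"
    using mult_smult_distrib[OF A X] mult_smult_distrib[OF A Y] by simp
  finally have "A * (a \<cdot>\<^sub>m X + b \<cdot>\<^sub>m Y) * B = (a \<cdot>\<^sub>m (A * X) + b \<cdot>\<^sub>m (A * Y)) * B"
    by simp
  also have "\<dots> = (a \<cdot>\<^sub>m (A * X)) * B + (b \<cdot>\<^sub>m (A * Y)) * B"
    by (rule add_mult_distrib_mat[of _ m n]) (use A B X Y in auto)
  also have "\<dots> = a \<cdot>\<^sub>m (A * X * B) + b \<cdot>\<^sub>m (A * Y * B)"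
    using mult_smult_assoc_mat[OF mult_carrier_mat[OF A X] B]
      mult_smult_assoc_mat[OF mult_carrier_mat[OF A Y] B] by simp
  finally show ?thesis .
qed

lemma mult_mat_diff:
  fixes A B X Y :: "real mat"
  assumes A: "A \<in> carrier_mat m p" and B: "B \<in> carrier_mat n l"
    and X: "X \<in> carrier_mat p n" and Y: "Y \<in> carrier_mat p n"
  shows "A * (X - Y) * B = A * X * B - A * Y * B"
  unfolding mult_minus_distrib_mat[OF A X Y]
  by (rule minus_mult_distrib_mat[OF mult_carrier_mat[OF A X] mult_carrier_mat[OF A Y] B])

text \<open>An exact identity for the square function, summed entrywise. Constant weights give the
  Frobenius norm, eigenvalue weights the penalty.\<close>

lemma weighted_square_sum_convex_combination:
  fixes a b :: "nat \<Rightarrow> nat \<Rightarrow> real"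
  shows "(\<Sum>i<m. \<Sum>j<n. ((1 - t) * a i j + t * b i j)\<^sup>2 * w i j)
    = (1 - t) * (\<Sum>i<m. \<Sum>j<n. (a i j)\<^sup>2 * w i j) + t * (\<Sum>i<m. \<Sum>j<n. (b i j)\<^sup>2 * w i j)
      - t * (1 - t) * (\<Sum>i<m. \<Sum>j<n. (a i j - b i j)\<^sup>2 * w i j)"
proof -
  have "((1 - t) * x + t * y)\<^sup>2 * c
      = (1 - t) * (x\<^sup>2 * c) + t * (y\<^sup>2 * c) - t * (1 - t) * ((x - y)\<^sup>2 * c)" for x y c :: real
    by (simp add: power2_eq_square algebra_simps)
  then show ?thesis
    by (simp add: sum.distrib sum_subtractf sum_distrib_left)
qed

lemma frob_norm_convex_combination:
  assumes A: "A \<in> carrier_mat m n" and B: "B \<in> carrier_mat m n"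
  shows "(frob_norm ((1 - t) \<cdot>\<^sub>m A + t \<cdot>\<^sub>m B))\<^sup>2
    = (1 - t) * (frob_norm A)\<^sup>2 + t * (frob_norm B)\<^sup>2 - t * (1 - t) * (frob_norm (A - B))\<^sup>2"
proof -
  have carriers: "(1 - t) \<cdot>\<^sub>m A + t \<cdot>\<^sub>m B \<in> carrier_mat m n" "A - B \<in> carrier_mat m n"
    using A B by auto
  show ?thesis
    using weighted_square_sum_convex_combination[where a = "\<lambda>i j. A $$ (i, j)"
        and b = "\<lambda>i j. B $$ (i, j)" and w = "\<lambda>_ _. 1" and t = t and m = m and n = n] A B
    by (simp add: frob_norm_square[OF A] frob_norm_square[OF B] frob_norm_square[OF carriers(1)]
        frob_norm_square[OF carriers(2)])
qed

text \<open>Comparing \<open>x\<close> with \<open>z t\<close> gives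
  \<open>0 \<le> t * (f y - f x - (1 - t) * q)\<close>; after division by \<open>t\<close>, letting
  \<open>t\<close> tend to 0 yields the whole of \<open>q\<close>.\<close>

lemma is_arg_min_strongly_convex:
  fixes f :: "'a \<Rightarrow> real"
  assumes min: "is_arg_min f (\<lambda>x. x \<in> S) x"
    and z: "\<And>t. 0 < t \<Longrightarrow> t < 1 \<Longrightarrow> z t \<in> S"
    and fz: "\<And>t. 0 < t \<Longrightarrow> t < 1 \<Longrightarrow> f (z t) = (1 - t) * f x + t * f y - t * (1 - t) * q"
  shows "f x + q \<le> f y"
proof -
  \<comment> \<open>Here \<open>u\<close> stands for \<open>1 - t\<close>, so that the limit becomes
    the passage from all \<open>u\<close> in the open unit interval to 1.\<close>
  have "u * q \<le> f y - f x" if u: "0 < u" "u < 1" for u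
  proof -
    have "f x \<le> f (z (1 - u))"
      using min z[of "1 - u"] u by (auto simp: is_arg_min_linorder)
    then have "0 \<le> (1 - u) * (f y - f x - u * q)"
      using fz[of "1 - u"] u by (simp add: algebra_simps)
    then show ?thesis
      using u by (simp add: zero_le_mult_iff)
  qed
  then have "q \<le> f y - f x"
    by (rule field_le_mult_one_interval)
  then show ?thesis by simp
qed

text \<open>Common form of the two trace terms. The weights stay general, so that the identity on
  convex combinations does not depend on the spectra.\<close>

definition spectral_penalty ::
    "real mat \<Rightarrow> real mat \<Rightarrow> (nat \<Rightarrow> nat \<Rightarrow> real) \<Rightarrow> real mat \<Rightarrow> real" where
  "spectral_penalty P Q w X
    = (\<Sum>i<dim_row P. \<Sum>j<dim_row Q. (spectral_coeffs P Q X $$ (i, j))\<^sup>2 * w i j)"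

text \<open>The row penalty is the column penalty of the transpose with \<open>P\<close> and
  \<open>Q\<close> exchanged. Both terms then involve the same squared coefficients, and their
  weights add.\<close>

lemma decoder_objective_spectral:
  assumes decomp_c: "sorted_eigendecomposition n Lc Q lamc"
    and decomp_r: "sorted_eigendecomposition p Lr P lamr"
    and X: "X \<in> carrier_mat p n"
  shows "decoder_objective Mr Mc Xt Lc Lr (gamma / a) (gamma / b) X
    = (frob_norm (Mr * X * Mc - Xt))\<^sup>2
      + gamma * spectral_penalty P Q (\<lambda>i j. lamc j / a + lamr i / b) X"
proof -
  have P: "P \<in> carrier_mat p p" "P\<^sup>T * P = 1\<^sub>m p" and Q: "Q \<in> carrier_mat n n" "Q\<^sup>T * Q = 1\<^sub>m n"
    using decomp_c decomp_r by (auto simp: sorted_eigendecomposition_def)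
  let ?Z = "spectral_coeffs P Q X"
  have Z: "?Z \<in> carrier_mat p n" by (rule spectral_coeffs_carrier[OF P(1) Q(1) X])
  have cols: "mat_trace (X * Lc * X\<^sup>T) = (\<Sum>i<p. \<Sum>j<n. (?Z $$ (i, j))\<^sup>2 * lamc j)"
    by (rule mat_trace_spectral_coeffs[OF P decomp_c X])
  have "mat_trace (X\<^sup>T * Lr * X) = (\<Sum>j<n. \<Sum>i<p. (?Z\<^sup>T $$ (j, i))\<^sup>2 * lamr i)"
    using mat_trace_spectral_coeffs[OF Q decomp_r, of "X\<^sup>T"] X
    by (simp add: spectral_coeffs_transpose[OF P(1) Q(1) X])
  also have "\<dots> = (\<Sum>j<n. \<Sum>i<p. (?Z $$ (i, j))\<^sup>2 * lamr i)"
    using Z by simp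
  also have "\<dots> = (\<Sum>i<p. \<Sum>j<n. (?Z $$ (i, j))\<^sup>2 * lamr i)"
    by (rule sum.swap)
  finally have rows: "mat_trace (X\<^sup>T * Lr * X) = (\<Sum>i<p. \<Sum>j<n. (?Z $$ (i, j))\<^sup>2 * lamr i)" .
  show ?thesis
    using P Q unfolding decoder_objective_def spectral_penalty_def cols rows
    by (simp add: sum_distrib_left sum.distrib algebra_simps)
qed

lemma spectral_coeffs_diff:
  assumes "P \<in> carrier_mat p p" "Q \<in> carrier_mat n n" "X \<in> carrier_mat p n" "Y \<in> carrier_mat p n"
    "i < p" "j < n"
  shows "spectral_coeffs P Q (X - Y) $$ (i, j)
    = spectral_coeffs P Q X $$ (i, j) - spectral_coeffs P Q Y $$ (i, j)"
proof -
  have "spectral_coeffs P Q (X - Y) = spectral_coeffs P Q X - spectral_coeffs P Q Y"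
    unfolding spectral_coeffs_def by (rule mult_mat_diff) (use assms in auto)
  then show ?thesis
    using assms carrier_matD[OF spectral_coeffs_carrier[OF assms(1,2,4)]] by simp
qed

lemma spectral_penalty_convex_combination:
  assumes P: "P \<in> carrier_mat p p" and Q: "Q \<in> carrier_mat n n"
    and X: "X \<in> carrier_mat p n" and Y: "Y \<in> carrier_mat p n"
  shows "spectral_penalty P Q w ((1 - t) \<cdot>\<^sub>m X + t \<cdot>\<^sub>m Y)
    = (1 - t) * spectral_penalty P Q w X + t * spectral_penalty P Q w Y
      - t * (1 - t) * spectral_penalty P Q w (X - Y)"
proof -
  let ?Z = "spectral_coeffs P Q"
  have Z: "?Z X \<in> carrier_mat p n" "?Z Y \<in> carrier_mat p n"
    using spectral_coeffs_carrier[OF P Q] X Y by auto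
  have "?Z ((1 - t) \<cdot>\<^sub>m X + t \<cdot>\<^sub>m Y) = (1 - t) \<cdot>\<^sub>m ?Z X + t \<cdot>\<^sub>m ?Z Y"
    unfolding spectral_coeffs_def by (rule mult_mat_linear_combination) (use P Q X Y in auto)
  then have "spectral_penalty P Q w ((1 - t) \<cdot>\<^sub>m X + t \<cdot>\<^sub>m Y)
      = (\<Sum>i<p. \<Sum>j<n. ((1 - t) * ?Z X $$ (i, j) + t * ?Z Y $$ (i, j))\<^sup>2 * w i j)"
    using P Q Z by (simp add: spectral_penalty_def)
  then show ?thesis
    using P Q by (simp add: weighted_square_sum_convex_combination spectral_penalty_def
        spectral_coeffs_diff[OF P Q X Y])
qed

text \<open>On the segment from \<open>X\<close> to \<open>Y\<close> the objective lies below its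
  chord by exactly \<open>t * (1 - t)\<close> times its quadratic part at \<open>X - Y\<close>,
  which is the situation of \<open>is_arg_min_strongly_convex\<close>.\<close>

lemma decoder_minimizer_bound:
  assumes decomp_c: "sorted_eigendecomposition n Lc Q lamc"
    and decomp_r: "sorted_eigendecomposition p Lr P lamr"
    and Mr: "Mr \<in> carrier_mat rhor p" and Mc: "Mc \<in> carrier_mat n rhoc"
    and Xt: "Xt \<in> carrier_mat rhor rhoc"
    and min: "is_arg_min (decoder_objective Mr Mc Xt Lc Lr (gamma / a) (gamma / b))
      (\<lambda>X. X \<in> carrier_mat p n) X"
    and Y: "Y \<in> carrier_mat p n"
  defines "R \<equiv> spectral_penalty P Q (\<lambda>i j. lamc j / a + lamr i / b)"
  shows "(frob_norm (Mr * X * Mc - Xt))\<^sup>2 + gamma * R X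
      + ((frob_norm (Mr * (X - Y) * Mc))\<^sup>2 + gamma * R (X - Y))
    \<le> (frob_norm (Mr * Y * Mc - Xt))\<^sup>2 + gamma * R Y"
proof -
  let ?f = "decoder_objective Mr Mc Xt Lc Lr (gamma / a) (gamma / b)"
  let ?fit = "\<lambda>X. Mr * X * Mc - Xt" and ?z = "\<lambda>t. (1 - t) \<cdot>\<^sub>m X + t \<cdot>\<^sub>m Y"
  have X: "X \<in> carrier_mat p n" using min by (simp add: is_arg_min_def)
  have P: "P \<in> carrier_mat p p" and Q: "Q \<in> carrier_mat n n"
    using decomp_c decomp_r by (auto simp: sorted_eigendecomposition_def)
  have f: "?f V = (frob_norm (?fit V))\<^sup>2 + gamma * R V" if "V \<in> carrier_mat p n" for V
    unfolding R_def by (rule decoder_objective_spectral[OF decomp_c decomp_r that])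
  have fit_carrier: "Mr * V * Mc \<in> carrier_mat rhor rhoc" if "V \<in> carrier_mat p n" for V
    by (rule mult_carrier_mat[OF mult_carrier_mat[OF Mr that] Mc])
  have fit_diff: "?fit X - ?fit Y = Mr * (X - Y) * Mc"
    unfolding mult_mat_diff[OF Mr Mc X Y]
    using fit_carrier[OF X] fit_carrier[OF Y] Xt Mr Mc
    by (intro eq_matI) (auto simp del: index_mult_mat(1))
  \<comment> \<open>The affine term \<open>Xt\<close> fits into the combination because the
    coefficients \<open>1 - t\<close> and \<open>t\<close> add up to 1.\<close>
  have fit_comb: "?fit (?z t) = (1 - t) \<cdot>\<^sub>m ?fit X + t \<cdot>\<^sub>m ?fit Y" for t
    unfolding mult_mat_linear_combination[OF Mr Mc X Y]
    using fit_carrier[OF X] fit_carrier[OF Y] Xt Mr Mc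
    by (intro eq_matI) (auto simp: algebra_simps simp del: index_mult_mat(1))
  have fits: "?fit X \<in> carrier_mat rhor rhoc" "?fit Y \<in> carrier_mat rhor rhoc"
    using Xt by auto
  have "?f X + ((frob_norm (Mr * (X - Y) * Mc))\<^sup>2 + gamma * R (X - Y)) \<le> ?f Y"
  proof (rule is_arg_min_strongly_convex[OF min])
    fix t :: real
    show z: "?z t \<in> carrier_mat p n" using X Y by simp
    show "?f (?z t) = (1 - t) * ?f X + t * ?f Y
        - t * (1 - t) * ((frob_norm (Mr * (X - Y) * Mc))\<^sup>2 + gamma * R (X - Y))"
      unfolding f[OF X] f[OF Y] f[OF z] fit_comb frob_norm_convex_combination[OF fits] fit_diff
      unfolding R_def spectral_penalty_convex_combination[OF P Q X Y]
      by (simp add: algebra_simps)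
  qed
  then show ?thesis by (simp only: f[OF X] f[OF Y])
qed

section \<open>The residual of the orthogonal projection\<close>

text \<open>The coefficient is the inner product of the residual with the basis matrix of index
  \<open>(i, j)\<close>, and that matrix belongs to the low-rank space for an index inside the
  block.\<close>

lemma frob_projection_residual_coeff:
  assumes P: "P \<in> carrier_mat p p" "P\<^sup>T * P = 1\<^sub>m p" and Q: "Q \<in> carrier_mat n n" "Q\<^sup>T * Q = 1\<^sub>m n"
    and k: "kr \<le> p" "kc \<le> n" and X: "X \<in> carrier_mat p n"
    and proj: "is_frob_projection (low_rank_space (first_columns kr P) (first_columns kc Q)) X Y"
    and ij: "i < kr" "j < kc"
  shows "spectral_coeffs P Q (X - Y) $$ (i, j) = 0"
proof -
  let ?S = "low_rank_space (first_columns kr P) (first_columns kc Q)"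
  let ?Z = "spectral_coeffs P Q"
  have Y: "Y \<in> carrier_mat p n"
    using proj by (simp add: is_frob_projection_def low_rank_space_iff[OF P Q k])
  have XY: "X - Y \<in> carrier_mat p n" by (rule minus_carrier_mat[OF Y])
  define U :: "real mat" where "U = mat p n (\<lambda>(a, b). if a = i \<and> b = j then 1 else 0)"
  define V where "V = P * U * Q\<^sup>T"
  have U: "U \<in> carrier_mat p n" by (simp add: U_def)
  have V: "V \<in> carrier_mat p n"
    unfolding V_def by (rule mult_carrier_mat[OF mult_carrier_mat[OF P(1) U]]) (use Q in simp)
  have PT: "P\<^sup>T \<in> carrier_mat p p" "P\<^sup>T\<^sup>T * P\<^sup>T = 1\<^sub>m p"
    using P orthogonal_right_inverse[OF P] by auto
  have QT: "Q\<^sup>T \<in> carrier_mat n n" "Q\<^sup>T\<^sup>T * Q\<^sup>T = 1\<^sub>m n"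
    using Q orthogonal_right_inverse[OF Q] by auto
  \<comment> \<open>For the transposed bases the expansion reads
    \<open>P\<^sup>T * (P * U * Q\<^sup>T) * Q = U\<close>.\<close>
  have ZV: "?Z V = U"
    using spectral_expansion(3)[OF PT QT U] by (simp add: spectral_coeffs_def V_def)
  have "V \<in> ?S"
    unfolding low_rank_space_iff[OF P Q k] ZV using V ij by (auto simp: U_def)
  then have "0 = frob_inner (X - Y) V"
    using proj by (simp add: is_frob_projection_def)
  also have "\<dots> = frob_inner (?Z (X - Y)) U"
    using frob_inner_spectral_coeffs[OF P Q XY V] by (simp add: ZV)
  also have "\<dots> = (\<Sum>a<p. \<Sum>b<n. if b = j then if a = i then ?Z (X - Y) $$ (a, b) else 0 else 0)"
    unfolding frob_inner_def carrier_matD[OF spectral_coeffs_carrier[OF P(1) Q(1) XY]]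
    by (intro sum.cong refl) (simp add: U_def)
  also have "\<dots> = ?Z (X - Y) $$ (i, j)"
    using ij k by simp
  finally show ?thesis by simp
qed

section \<open>The error bounds for the decoder\<close>

theorem theorem3:
  fixes n p kc kr rhoc rhor :: nat
    and Wc Wr Lc Lr Q P Mc Mr Xbar Et Xt Xs Xbars Es :: "real mat"
    and lamc lamr :: "nat \<Rightarrow> real"
    and delta gamma gammac gammar :: real
  assumes "weight_matrix n Wc" and "Lc = laplacian n Wc"
    and "weight_matrix p Wr" and "Lr = laplacian p Wr"
    and "sorted_eigendecomposition n Lc Q lamc"
    and "sorted_eigendecomposition p Lr P lamr"
    and "1 \<le> kc" and "kc < n" and "1 \<le> kr" and "kr < p"
    and "0 < rhoc" and "0 < rhor"
    and "0 < delta" and "delta < 1"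
    and "row_subsampling p rhor Mr" and "column_subsampling n rhoc Mc"
    and "\<forall>Y \<in> low_rank_space (first_columns kr P) (first_columns kc Q).
           (1 - delta) * (frob_norm Y)\<^sup>2
             \<le> real n * real p / (real rhor * real rhoc) * (frob_norm (Mr * Y * Mc))\<^sup>2
         \<and> real n * real p / (real rhor * real rhoc) * (frob_norm (Mr * Y * Mc))\<^sup>2
             \<le> (1 + delta) * (frob_norm Y)\<^sup>2"
    and "0 < gamma" and "0 < lamc kc" and "0 < lamr kr"
    and "gammac = gamma / lamc kc" and "gammar = gamma / lamr kr"
    and "Xbar \<in> low_rank_space (first_columns kr P) (first_columns kc Q)"
    and "Et \<in> carrier_mat rhor rhoc"
    and "Xt = Mr * Xbar * Mc + Et"
    and "is_arg_min (decoder_objective Mr Mc Xt Lc Lr gammac gammar)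
           (\<lambda>X. X \<in> carrier_mat p n) Xs"
    and "is_frob_projection
           (low_rank_space (first_columns kr P) (first_columns kc Q)) Xs Xbars"
    and "Es = Xs - Xbars"
  shows "frob_norm (Xbars - Xbar)
           \<le> sqrt (real n * real p / (real rhoc * real rhor * (1 - delta)))
             * ((2 + 1 / sqrt (2 * gamma)) * frob_norm Et
                + (1 / sqrt 2 + sqrt gamma)
                  * sqrt (lamc (kc - 1) / lamc kc + lamr (kr - 1) / lamr kr)
                  * frob_norm Xbar)
       \<and> frob_norm Es
           \<le> frob_norm Et / sqrt (2 * gamma)
             + 1 / sqrt 2 * sqrt (lamc (kc - 1) / lamc kc + lamr (kr - 1) / lamr kr)
               * frob_norm Xbar"
proof -
  note decomp_c = assms(5) and decomp_r = assms(6)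
  let ?S = "low_rank_space (first_columns kr P) (first_columns kc Q)"
  have P: "P \<in> carrier_mat p p" "P\<^sup>T * P = 1\<^sub>m p" and Q: "Q \<in> carrier_mat n n" "Q\<^sup>T * Q = 1\<^sub>m n"
    and mono_c: "mono_on {..<n} lamc" and mono_r: "mono_on {..<p} lamr"
    using decomp_c decomp_r by (auto simp: sorted_eigendecomposition_def)
  have k: "kr \<le> p" "kc \<le> n" using assms(8,10) by auto
  note low_rank = low_rank_space_iff[OF P Q k]
  have Mr: "Mr \<in> carrier_mat rhor p" and Mc: "Mc \<in> carrier_mat n rhoc"
    using assms(15,16) by (auto intro: row_subsampling_carrier column_subsampling_carrier)
  have Xbar: "Xbar \<in> carrier_mat p n" and Xs: "Xs \<in> carrier_mat p n" and Xbars: "Xbars \<in> carrier_mat p n"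
    and Xbars_S: "Xbars \<in> ?S"
    using assms(23,26,27) low_rank by (auto simp: is_arg_min_def is_frob_projection_def)
  have Es: "Es \<in> carrier_mat p n" and D: "Xs - Xbar \<in> carrier_mat p n"
    and H: "Xbars - Xbar \<in> carrier_mat p n"
    using Xbars Xbar by (auto simp: assms(28))
  have MXM: "Mr * V * Mc \<in> carrier_mat rhor rhoc" if "V \<in> carrier_mat p n" for V
    by (rule mult_carrier_mat[OF mult_carrier_mat[OF Mr that] Mc])
  have Et: "Et \<in> carrier_mat rhor rhoc" by (rule assms(24))
  have Xt: "Xt \<in> carrier_mat rhor rhoc"
    unfolding assms(25) using Et by (rule add_carrier_mat)

  define w where "w i j = lamc j / lamc kc + lamr i / lamr kr" for i j
  define R where "R = spectral_penalty P Q w"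
  \<comment> \<open>\<open>s\<close> is the weight at the corner \<open>(kr - 1, kc - 1)\<close> of
    the block, the largest one there because both spectra are sorted. The subtractions are genuine
    since \<open>kc\<close> and \<open>kr\<close> are at least 1.\<close>
  define s where "s = lamc (kc - 1) / lamc kc + lamr (kr - 1) / lamr kr"
  let ?Z = "spectral_coeffs P Q"
  have lam_nonneg: "0 \<le> lamc j" "0 \<le> lamr i" if "i < p" "j < n" for i j
    using laplacian_eigenvalue_nonneg[OF assms(1)] laplacian_eigenvalue_nonneg[OF assms(3)]
      decomp_c decomp_r that by (auto simp: assms(2,4))
  have w_nonneg: "0 \<le> w i j" if "i < p" "j < n" for i j
    using lam_nonneg[OF that] assms(19,20) by (simp add: w_def)
  \<comment> \<open>Past the cut one summand is at least 1 by monotonicity, and the other cannot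
    lower the sum because Laplacian eigenvalues are nonnegative.\<close>
  have w_ge_1: "1 \<le> w i j" if "i < p" "j < n" "kr \<le> i \<or> kc \<le> j" for i j
  proof (cases "kc \<le> j")
    case True
    then have "1 \<le> lamc j / lamc kc"
      using mono_onD[OF mono_c, of kc j] that assms(19) by (simp add: le_divide_eq)
    then show ?thesis using lam_nonneg[OF that(1,2)] assms(20) by (simp add: w_def add_increasing2)
  next
    case False
    then have "1 \<le> lamr i / lamr kr"
      using mono_onD[OF mono_r, of kr i] that assms(20) by (simp add: le_divide_eq)
    then show ?thesis using lam_nonneg[OF that(1,2)] assms(19) by (simp add: w_def add_increasing)
  qed
  have w_le_s: "w i j \<le> s" if "i < kr" "j < kc" for i j
    unfolding w_def s_def using that k assms(19,20)
    by (intro add_mono divide_right_mono mono_onD[OF mono_c] mono_onD[OF mono_r]) auto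
  have s_nonneg: "0 \<le> s"
    unfolding s_def using lam_nonneg[of "kr - 1" "kc - 1"] assms(7-10,19,20) by auto

  have R: "R V = (\<Sum>i<p. \<Sum>j<n. (?Z V $$ (i, j))\<^sup>2 * w i j)" for V
    using P Q by (simp add: R_def spectral_penalty_def)
  have norm_Z: "(frob_norm V)\<^sup>2 = (\<Sum>i<p. \<Sum>j<n. (?Z V $$ (i, j))\<^sup>2)" if "V \<in> carrier_mat p n" for V
    using frob_norm_square[OF spectral_coeffs_carrier[OF P(1) Q(1) that]]
      frob_inner_spectral_coeffs[OF P Q that that] by (simp add: frob_norm_def)
  have S_zero: "?Z V $$ (i, j) = 0" if "V \<in> ?S" "i < p" "j < n" "kr \<le> i \<or> kc \<le> j" for V i j
    using that unfolding low_rank by blast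
  have Es_zero: "?Z Es $$ (i, j) = 0" if "i < kr" "j < kc" for i j
    unfolding assms(28) by (rule frob_projection_residual_coeff[OF P Q k Xs assms(27) that])
  have Z_Es: "?Z Es $$ (i, j) = ?Z Xs $$ (i, j) - ?Z Xbars $$ (i, j)" if "i < p" "j < n" for i j
    unfolding assms(28) by (rule spectral_coeffs_diff[OF P(1) Q(1) Xs Xbars that])
  \<comment> \<open>Outside the block neither \<open>Xbars\<close> nor \<open>Y\<close> has
    coefficients, so \<open>Es\<close> and \<open>Xs - Y\<close> agree there and the weight is at
    least 1; inside the block \<open>Es\<close> has none. A general \<open>Y\<close> covers both
    \<open>Xbar\<close> and zero.\<close>
  have R_residual: "(frob_norm Es)\<^sup>2 \<le> R (Xs - Y)" if Y: "Y \<in> carrier_mat p n"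
    and Y_zero: "\<And>i j. i < p \<Longrightarrow> j < n \<Longrightarrow> kr \<le> i \<or> kc \<le> j \<Longrightarrow> ?Z Y $$ (i, j) = 0" for Y
    unfolding norm_Z[OF Es] R
  proof (intro sum_mono)
    fix i j assume ij: "i \<in> {..<p}" "j \<in> {..<n}"
    show "(?Z Es $$ (i, j))\<^sup>2 \<le> (?Z (Xs - Y) $$ (i, j))\<^sup>2 * w i j"
    proof (cases "kr \<le> i \<or> kc \<le> j")
      case True
      then have "?Z Es $$ (i, j) = ?Z (Xs - Y) $$ (i, j)"
        using ij Y_zero S_zero[OF Xbars_S] Z_Es spectral_coeffs_diff[OF P(1) Q(1) Xs Y] by simp
      then show ?thesis
        using mult_left_mono[OF w_ge_1, of i j "(?Z (Xs - Y) $$ (i, j))\<^sup>2"] True ij by simp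
    next
      case False
      then show ?thesis using Es_zero w_nonneg ij by simp
    qed
  qed
  have R_D: "(frob_norm Es)\<^sup>2 \<le> R (Xs - Xbar)"
    using S_zero[OF assms(23)] by (rule R_residual[OF Xbar])
  \<comment> \<open>The choice of zero for \<open>Y\<close> bounds the penalty of \<open>Xs\<close>
    itself, the second place where \<open>Es\<close> enters the growth inequality.\<close>
  have "(frob_norm Es)\<^sup>2 \<le> R (Xs - 0\<^sub>m p n)"
  proof (rule R_residual)
    fix i j assume "i < p" "j < n"
    then show "?Z (0\<^sub>m p n) $$ (i, j) = 0"
      using P Q by (simp add: spectral_coeffs_def)
  qed simp
  moreover have "Xs - 0\<^sub>m p n = Xs"
    using Xs by (intro eq_matI) auto
  ultimately have R_Xs: "(frob_norm Es)\<^sup>2 \<le> R Xs"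
    by simp
  have R_Xbar: "R Xbar \<le> s * (frob_norm Xbar)\<^sup>2"
    unfolding norm_Z[OF Xbar] R sum_distrib_left
  proof (intro sum_mono)
    fix i j assume ij: "i \<in> {..<p}" "j \<in> {..<n}"
    show "(?Z Xbar $$ (i, j))\<^sup>2 * w i j \<le> s * (?Z Xbar $$ (i, j))\<^sup>2"
    proof (cases "kr \<le> i \<or> kc \<le> j")
      case True
      then show ?thesis using S_zero[OF assms(23)] ij by simp
    next
      case False
      then show ?thesis
        using mult_right_mono[OF w_le_s, of i j "(?Z Xbar $$ (i, j))\<^sup>2"] by (simp add: mult.commute)
    qed
  qed

  define fit where "fit = Mr * Xs * Mc - Xt"
  have fit: "fit \<in> carrier_mat rhor rhoc"
    unfolding fit_def by (rule minus_carrier_mat[OF Xt])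
  have "Mr * Xbar * Mc - Xt = - Et"
    unfolding assms(25) using MXM[OF Xbar] Et Mr Mc
    by (intro eq_matI) (auto simp del: index_mult_mat(1))
  then have Et_norm: "frob_norm (Mr * Xbar * Mc - Xt) = frob_norm Et"
    by (simp add: frob_norm_uminus)
  have "(frob_norm fit)\<^sup>2 + gamma * R Xs
      + ((frob_norm (Mr * (Xs - Xbar) * Mc))\<^sup>2 + gamma * R (Xs - Xbar))
      \<le> (frob_norm Et)\<^sup>2 + gamma * R Xbar"
    using decoder_minimizer_bound[OF decomp_c decomp_r Mr Mc Xt assms(26)[unfolded assms(21,22)] Xbar]
    by (simp only: Et_norm fit_def R_def w_def[abs_def])
  moreover have "gamma * R Xbar \<le> gamma * (s * (frob_norm Xbar)\<^sup>2)"
    "gamma * (frob_norm Es)\<^sup>2 \<le> gamma * R Xs" "gamma * (frob_norm Es)\<^sup>2 \<le> gamma * R (Xs - Xbar)"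
    using assms(18) R_Xbar R_Xs R_D by auto
  \<comment> \<open>The penalties of \<open>Xs\<close> and of \<open>Xs - Xbar\<close> each
    contribute \<open>gamma * (frob_norm Es)\<^sup>2\<close>, whence the factor 2; the sampled norm
    of \<open>Xs - Xbar\<close> is dropped as nonnegative.\<close>
  ultimately have main: "(frob_norm fit)\<^sup>2 + 2 * gamma * (frob_norm Es)\<^sup>2
      \<le> (frob_norm Et)\<^sup>2 + gamma * s * (frob_norm Xbar)\<^sup>2"
    using zero_le_power2[of "frob_norm (Mr * (Xs - Xbar) * Mc)"] unfolding mult.assoc by linarith

  note nonneg = frob_norm_nonneg[of Es] frob_norm_nonneg[of Et] frob_norm_nonneg[of Xbar]
    frob_norm_nonneg[of fit] s_nonneg assms(18)
  have sqrt_add: "sqrt (x\<^sup>2 + y\<^sup>2) \<le> x + y" if "0 \<le> x" "0 \<le> y" for x y :: real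
    using that by (intro real_le_lsqrt) (auto simp: power2_sum)
  \<comment> \<open>The \<open>fit\<close> term of \<open>main\<close> is dropped, the rest divided
    by \<open>2 * gamma\<close>, and the root of the two squares split by
    \<open>sqrt_add\<close>.\<close>
  have Es_bound: "frob_norm Es
      \<le> frob_norm Et / sqrt (2 * gamma) + 1 / sqrt 2 * sqrt s * frob_norm Xbar"
  proof (rule order_trans[OF _ sqrt_add])
    have "2 * gamma * (frob_norm Es)\<^sup>2 \<le> (frob_norm Et)\<^sup>2 + gamma * s * (frob_norm Xbar)\<^sup>2"
      using main zero_le_power2[of "frob_norm fit"] by linarith
    then have "(frob_norm Es)\<^sup>2
        \<le> (frob_norm Et / sqrt (2 * gamma))\<^sup>2 + (1 / sqrt 2 * sqrt s * frob_norm Xbar)\<^sup>2"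
      using nonneg by (simp add: power_mult_distrib power_divide field_simps)
    then show "frob_norm Es
        \<le> sqrt ((frob_norm Et / sqrt (2 * gamma))\<^sup>2 + (1 / sqrt 2 * sqrt s * frob_norm Xbar)\<^sup>2)"
      by (rule real_le_rsqrt)
  qed (use nonneg in auto)
  \<comment> \<open>Here the \<open>Es\<close> term of \<open>main\<close> is dropped
    instead.\<close>
  have fit_bound: "frob_norm fit \<le> frob_norm Et + sqrt gamma * sqrt s * frob_norm Xbar"
  proof (rule order_trans[OF _ sqrt_add])
    have "(frob_norm fit)\<^sup>2 \<le> (frob_norm Et)\<^sup>2 + gamma * s * (frob_norm Xbar)\<^sup>2"
      using main nonneg by (smt (verit) mult_nonneg_nonneg zero_le_power2)
    then show "frob_norm fit \<le> sqrt ((frob_norm Et)\<^sup>2 + (sqrt gamma * sqrt s * frob_norm Xbar)\<^sup>2)"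
      using nonneg by (intro real_le_rsqrt) (simp add: power_mult_distrib)
  qed (use nonneg in auto)

  \<comment> \<open>Sampling \<open>Xbars - Xbar = (Xs - Xbar) - Es\<close>, where the sampled
    \<open>Xs - Xbar\<close> equals \<open>fit + Et\<close> by the definition of
    \<open>Xt\<close>.\<close>
  have "Mr * (Xbars - Xbar) * Mc = fit + Et - Mr * Es * Mc"
    unfolding assms(28) fit_def assms(25) mult_mat_diff[OF Mr Mc Xbars Xbar]
      mult_mat_diff[OF Mr Mc Xs Xbars]
    using MXM[OF Xbar] MXM[OF Xs] MXM[OF Xbars] Et Mr Mc
    by (intro eq_matI) (auto simp del: index_mult_mat(1))
  then have "frob_norm (Mr * (Xbars - Xbar) * Mc) \<le> frob_norm (fit + Et) + frob_norm (Mr * Es * Mc)"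
    using frob_norm_triangle_diff[OF add_carrier_mat[OF Et, of fit] MXM[OF Es]] by simp
  also have "\<dots> \<le> frob_norm fit + frob_norm Et + frob_norm Es"
    using frob_norm_triangle[OF fit Et] frob_norm_subsampling[OF assms(15,16) Es] by linarith
  \<comment> \<open>The 2 counts \<open>Et\<close> once by itself and once from
    \<open>fit_bound\<close>, which also gives \<open>sqrt gamma\<close>; the remaining summands
    come from \<open>Es_bound\<close>.\<close>
  also have "\<dots> \<le> (2 + 1 / sqrt (2 * gamma)) * frob_norm Et
      + (1 / sqrt 2 + sqrt gamma) * sqrt s * frob_norm Xbar"
    using fit_bound Es_bound by (simp add: algebra_simps)
  finally have sampled: "frob_norm (Mr * (Xbars - Xbar) * Mc)
      \<le> (2 + 1 / sqrt (2 * gamma)) * frob_norm Et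
        + (1 / sqrt 2 + sqrt gamma) * sqrt s * frob_norm Xbar" .

  \<comment> \<open>Vanishing of coefficients is preserved by differences, so the lower isometry
    bound applies to the projected error.\<close>
  have "Xbars - Xbar \<in> ?S"
    unfolding low_rank using H S_zero[OF Xbars_S] S_zero[OF assms(23)]
    by (simp add: spectral_coeffs_diff[OF P(1) Q(1) Xbars Xbar])
  then have "(1 - delta) * (frob_norm (Xbars - Xbar))\<^sup>2
      \<le> real n * real p / (real rhor * real rhoc) * (frob_norm (Mr * (Xbars - Xbar) * Mc))\<^sup>2"
    using assms(17) by blast
  then have "(frob_norm (Xbars - Xbar))\<^sup>2
      \<le> real n * real p / (real rhoc * real rhor * (1 - delta))
        * (frob_norm (Mr * (Xbars - Xbar) * Mc))\<^sup>2"
    using assms(11,12,14) by (simp add: field_simps)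
  then have "frob_norm (Xbars - Xbar)
      \<le> sqrt (real n * real p / (real rhoc * real rhor * (1 - delta))
        * (frob_norm (Mr * (Xbars - Xbar) * Mc))\<^sup>2)"
    by (rule real_le_rsqrt)
  also have "\<dots> = sqrt (real n * real p / (real rhoc * real rhor * (1 - delta)))
      * frob_norm (Mr * (Xbars - Xbar) * Mc)"
    by (subst real_sqrt_mult) (simp only: real_sqrt_abs abs_of_nonneg frob_norm_nonneg)
  also have "\<dots> \<le> sqrt (real n * real p / (real rhoc * real rhor * (1 - delta)))
      * ((2 + 1 / sqrt (2 * gamma)) * frob_norm Et
        + (1 / sqrt 2 + sqrt gamma) * sqrt s * frob_norm Xbar)"
    using assms(14) by (intro mult_left_mono[OF sampled]) simp
  finally show ?thesis
    using Es_bound by (simp add: s_def)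
qed

end
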